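(* Let $x_1,\dots,x_n\in\mathbb{R}^p$, $c\ge2$, and let $\mathcal I\subset(1,\infty)$ be an interval. Let $m\mapsto v_j(m)\in\mathbb{R}^p$, $j=1,\dots,c$, be $C^1$ on $\mathcal I$. In the GK case, let in addition $m\mapsto A_j(m)$, $j=1,\dots,c$, be $C^1$ maps from $\mathcal I$ to symmetric positive definite real $p\times p$ matrices. Define $$d_{ij}(m)=\begin{cases}\|x_i-v_j(m)\|, & \text{SFCM case},\\ \sqrt{(x_i-v_j(m))^\top A_j(m)(x_i-v_j(m))}, & \text{GK case},\end{cases}$$ and assume $d_{ij}(m)>0$ for all $i,j$ and all $m\in\mathcal I$. Set $$r_{ijk}(m)=\frac{d_{ij}(m)}{d_{ik}(m)},\quad b(m)=\frac{2}{m-1},\quad D_{ij}(m)=\sum_{k=1}^{c}r_{ijk}(m)^{b(m)},\quad u_{ij}(m)=\frac1{D_{ij}(m)}.$$ Then, in either case, for all $i\in\{1,\dots,n\}$ and $j\in\{1,\dots,c\}$: (i) $u_{ij}(m)\in(0,1)$ for all $m\in\mathcal I$; (ii) $u_{ij}$ is of class $C^1$ on $\mathcal I$; (iii) $\sum_{j=1}^c u_{ij}(m)=1$ for all $i$ and all $m\in\mathcal I$; (iv) $u_{ij}'(m)=T_1(m)+T_2(m)$, where $$T_1(m)=\frac{2u_{ij}(m)^2}{(m-1)^2}\sum_{k=1}^{c}r_{ijk}(m)^{b(m)}\ln r_{ijk}(m),$$ and, with $$w_{ijl}(m)=\begin{cases}D_{ij}(m)-1,& l=j,\\ -r_{ijl}(m)^{b(m)},&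 l\ne j,\end{cases}$$ the term $T_2$ is given in the SFCM case by $$T_2(m)=\frac{2u_{ij}(m)^2}{m-1}\sum_{l=1}^{c}\frac{w_{ijl}(m)}{d_{il}(m)^2}\,(x_i-v_l(m))^\top\dot v_l(m),$$ and in the GK case by $$T_2(m)=\frac{2u_{ij}(m)^2}{m-1}\sum_{l=1}^{c}\frac{w_{ijl}(m)}{d_{il}(m)^2}\Big[(x_i-v_l(m))^\top A_l(m)\dot v_l(m)-\tfrac12(x_i-v_l(m))^\top\dot A_l(m)(x_i-v_l(m))\Big].$$
   Context: The norm $\|\cdot\|$ is Euclidean, and dots and primes denote $d/dm$ (one-sided at any endpoint contained in $\mathcal I$). The points $v_j(m)$ are cluster centres and $A_j(m)$ are the cluster-adaptive (Gustafson-Kessel) matrices, both depending on the fuzzifier $m$. The quantity $u_{ij}(m)$ is the fuzzy membership of $x_i$ in cluster $j$. *)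

theory Defs
  imports "HOL-Analysis.Analysis"
begin

(* Unlike C1_differentiable_on, this uses derivatives relative to S, so that they are
   one-sided at endpoints of an interval that belong to it. *)
definition C1_within :: "real set \<Rightarrow> (real \<Rightarrow> 'a::real_normed_vector) \<Rightarrow> bool" where
  "C1_within S f \<longleftrightarrow>
     (\<exists>f'. (\<forall>m\<in>S. (f has_vector_derivative f' m) (at m within S)) \<and> continuous_on S f')"

definition sym_pos_def :: "real^'p^'p \<Rightarrow> bool" where
  "sym_pos_def M \<longleftrightarrow> transpose M = M \<and> (\<forall>y. y \<noteq> 0 \<longrightarrow> y \<bullet> (M *v y) > 0)"

datatype variant = SFCM | GK

(* The matrices A are ignored in the SFCM variant. *)
definition cdist ::
  "variant \<Rightarrow> (nat \<Rightarrow> real^'p) \<Rightarrow> (nat \<Rightarrow> real \<Rightarrow> real^'p) \<Rightarrow> (nat \<Rightarrow> real \<Rightarrow> real^'p^'p) \<Rightarrow>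
   nat \<Rightarrow> nat \<Rightarrow> real \<Rightarrow> real" where
  "cdist alg x v A i j m =
     (case alg of
        SFCM \<Rightarrow> norm (x i - v j m)
      | GK \<Rightarrow> sqrt ((x i - v j m) \<bullet> (A j m *v (x i - v j m))))"

(* Below, d i j m is the distance of the i-th data point from the j-th centre at fuzzifier m,
   and c is the number of clusters. *)

definition ratio :: "(nat \<Rightarrow> nat \<Rightarrow> real \<Rightarrow> real) \<Rightarrow> nat \<Rightarrow> nat \<Rightarrow> nat \<Rightarrow> real \<Rightarrow> real" where
  "ratio d i j k m = d i j m / d i k m"

definition bexp :: "real \<Rightarrow> real" where
  "bexp m = 2 / (m - 1)"

definition Dsum :: "nat \<Rightarrow> (nat \<Rightarrow> nat \<Rightarrow> real \<Rightarrow> real) \<Rightarrow> nat \<Rightarrow> nat \<Rightarrow> real \<Rightarrow> real" where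
  "Dsum c d i j m = (\<Sum>k=1..c. ratio d i j k m powr bexp m)"

definition membership :: "nat \<Rightarrow> (nat \<Rightarrow> nat \<Rightarrow> real \<Rightarrow> real) \<Rightarrow> nat \<Rightarrow> nat \<Rightarrow> real \<Rightarrow> real" where
  "membership c d i j m = 1 / Dsum c d i j m"

definition T1 :: "nat \<Rightarrow> (nat \<Rightarrow> nat \<Rightarrow> real \<Rightarrow> real) \<Rightarrow> nat \<Rightarrow> nat \<Rightarrow> real \<Rightarrow> real" where
  "T1 c d i j m =
     2 * (membership c d i j m)\<^sup>2 / (m - 1)\<^sup>2 *
     (\<Sum>k=1..c. ratio d i j k m powr bexp m * ln (ratio d i j k m))"

definition weight ::
  "nat \<Rightarrow> (nat \<Rightarrow> nat \<Rightarrow> real \<Rightarrow> real) \<Rightarrow> nat \<Rightarrow> nat \<Rightarrow> nat \<Rightarrow> real \<Rightarrow> real" where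
  "weight c d i j l m =
     (if l = j then Dsum c d i j m - 1 else - (ratio d i j l m powr bexp m))"

definition T2 ::
  "variant \<Rightarrow> real set \<Rightarrow> nat \<Rightarrow> (nat \<Rightarrow> real^'p) \<Rightarrow> (nat \<Rightarrow> real \<Rightarrow> real^'p) \<Rightarrow>
   (nat \<Rightarrow> real \<Rightarrow> real^'p^'p) \<Rightarrow> nat \<Rightarrow> nat \<Rightarrow> real \<Rightarrow> real" where
  "T2 alg I c x v A i j m =
     (let d = cdist alg x v A;
          dv = (\<lambda>l. vector_derivative (v l) (at m within I));
          dA = (\<lambda>l. vector_derivative (A l) (at m within I))
      in 2 * (membership c d i j m)\<^sup>2 / (m - 1) *
         (\<Sum>l=1..c. weight c d i j l m / (d i l m)\<^sup>2 *
            (case alg of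
               SFCM \<Rightarrow> (x i - v l m) \<bullet> dv l
             | GK \<Rightarrow> (x i - v l m) \<bullet> (A l m *v dv l)
                     - 1/2 * ((x i - v l m) \<bullet> (dA l *v (x i - v l m))))))"

end

theory Submission
  imports Defs
begin

text \<open>Let \<open>g\<^sub>l\<close> be the bracket multiplying the weight in \<open>T2\<close>. Differentiating \<open>d\<^sub>i\<^sub>l\<^sup>2\<close> gives
  \<open>d\<^sub>i\<^sub>l d\<^sub>i\<^sub>l' = - g\<^sub>l\<close>; in the GK case the symmetry of \<open>A\<^sub>l\<close> merges the two terms
  containing \<open>v\<^sub>l'\<close>. Hence the part of \<open>D\<^sub>i\<^sub>j'\<close> that does not come from \<open>b'\<close> is \<open>- b\<close> times the
  sum over \<open>k\<close> of \<open>r\<^sub>i\<^sub>j\<^sub>k\<^sup>b (g\<^sub>j / d\<^sub>i\<^sub>j\<^sup>2 - g\<^sub>k / d\<^sub>i\<^sub>k\<^sup>2)\<close>,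
  and collecting the coefficient of each \<open>g\<^sub>l\<close> produces the weights. Since \<open>D\<^sub>i\<^sub>j\<close> is
  \<open>d\<^sub>i\<^sub>j\<^sup>b\<close> times a factor independent of \<open>j\<close>, the memberships sum to one.\<close>

text \<open>Supplies both the product rule and the continuity of \<open>A t *v y t\<close> when
  matrix and vector vary together.\<close>

lemma bounded_bilinear_matrix_vector_mult:
  "bounded_bilinear ((*v) :: real^'n^'m \<Rightarrow> real^'n \<Rightarrow> real^'m)"
  unfolding bilinear_conv_bounded_bilinear[symmetric] bilinear_def
  by (auto intro!: linearI simp: algebra_simps scaleR_matrix_vector_assoc)

lemma inner_symmetric_matrix:
  fixes A :: "real^'n^'n"
  assumes "transpose A = A"
  shows "a \<bullet> (A *v b) = b \<bullet> (A *v a)"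
  by (metis assms dot_lmul_matrix inner_commute vector_transpose_matrix)

lemma has_real_derivative_quadratic_form:
  fixes y :: "real \<Rightarrow> real^'n" and B :: "real \<Rightarrow> real^'n^'n"
  assumes y: "(y has_vector_derivative y') (at m within S)"
    and B: "(B has_vector_derivative B') (at m within S)"
    and sym: "transpose (B m) = B m"
  shows "((\<lambda>t. y t \<bullet> (B t *v y t)) has_real_derivative
           2 * (y m \<bullet> (B m *v y')) + y m \<bullet> (B' *v y m)) (at m within S)"
proof -
  note By = bounded_bilinear.has_vector_derivative[OF bounded_bilinear_matrix_vector_mult B y]
  have "((\<lambda>t. y t \<bullet> (B t *v y t)) has_vector_derivative
          y m \<bullet> (B m *v y' + B' *v y m) + y' \<bullet> (B m *v y m)) (at m within S)"
    by (rule bounded_bilinear.has_vector_derivative[OF bounded_bilinear_inner y By])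
  then show ?thesis
    using inner_symmetric_matrix[OF sym, of y' "y m"]
    by (simp add: has_real_derivative_iff_has_vector_derivative inner_add_right algebra_simps)
qed

text \<open>The derivatives are parameters because on a degenerate interval they are not unique, so that the
  continuous ones provided by \<^const>\<open>C1_within\<close> need not be those chosen by \<^const>\<open>vector_derivative\<close>.\<close>

definition dist_slope ::
  "variant \<Rightarrow> (nat \<Rightarrow> real^'p) \<Rightarrow> (nat \<Rightarrow> real \<Rightarrow> real^'p) \<Rightarrow> (nat \<Rightarrow> real \<Rightarrow> real^'p^'p) \<Rightarrow>
   (nat \<Rightarrow> real \<Rightarrow> real^'p) \<Rightarrow> (nat \<Rightarrow> real \<Rightarrow> real^'p^'p) \<Rightarrow> nat \<Rightarrow> nat \<Rightarrow> real \<Rightarrow> real" where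
  "dist_slope alg x v A v' A' i l m =
     (case alg of
        SFCM \<Rightarrow> (x i - v l m) \<bullet> v' l m
      | GK \<Rightarrow> (x i - v l m) \<bullet> (A l m *v v' l m)
              - 1/2 * ((x i - v l m) \<bullet> (A' l m *v (x i - v l m))))"

lemma T2_dist_slope:
  "T2 alg I c x v A i j m =
     2 * (membership c (cdist alg x v A) i j m)\<^sup>2 / (m - 1) *
     (\<Sum>l=1..c. weight c (cdist alg x v A) i j l m / (cdist alg x v A i l m)\<^sup>2 *
        dist_slope alg x v A (\<lambda>l m. vector_derivative (v l) (at m within I))
          (\<lambda>l m. vector_derivative (A l) (at m within I)) i l m)"
  by (simp add: T2_def dist_slope_def Let_def)

lemma cdist_has_real_derivative:
  assumes v: "(v l has_vector_derivative v' l m) (at m within I)"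
    and A: "alg = GK \<Longrightarrow> (A l has_vector_derivative A' l m) (at m within I)"
    and sym: "alg = GK \<Longrightarrow> transpose (A l m) = A l m"
    and pos: "cdist alg x v A i l m > 0"
  shows "(cdist alg x v A i l has_real_derivative
           - dist_slope alg x v A v' A' i l m / cdist alg x v A i l m) (at m within I)"
proof -
  have y: "((\<lambda>t. x i - v l t) has_vector_derivative - v' l m) (at m within I)"
    using v by (auto intro!: derivative_eq_intros)
  \<comment> \<open>Both variants become one quadratic form: SFCM takes \<open>B\<close> constantly
    the identity with \<open>B' = 0\<close>, GK takes \<open>B = A l\<close>. The chain rule for
    \<open>sqrt\<close> is then applied once.\<close>
  obtain B B' where
    cdist_eq: "cdist alg x v A i l = (\<lambda>t. sqrt ((x i - v l t) \<bullet> (B t *v (x i - v l t))))"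
    and B: "(B has_vector_derivative B') (at m within I)" "transpose (B m) = B m"
    and slope: "dist_slope alg x v A v' A' i l m =
      (x i - v l m) \<bullet> (B m *v v' l m) - 1/2 * ((x i - v l m) \<bullet> (B' *v (x i - v l m)))"
  proof (cases alg)
    case SFCM
    then show ?thesis
      by (intro that[of "\<lambda>_. mat 1" 0])
        (auto simp: cdist_def dist_slope_def norm_eq_sqrt_inner transpose_mat)
  next
    case GK
    then show ?thesis
      using A sym by (intro that[of "A l" "A' l m"]) (auto simp: cdist_def dist_slope_def)
  qed
  have "(x i - v l m) \<bullet> (B m *v (x i - v l m)) > 0"
    using pos unfolding cdist_eq by simp
  moreover have "B m *v (- v' l m) = - (B m *v v' l m)"
    by (simp add: vec.neg)
  ultimately show ?thesis
    using has_real_derivative_quadratic_form[OF y B] unfolding cdist_eq slope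
    by (auto intro!: derivative_eq_intros simp: field_simps)
qed

text \<open>The term \<open>k = j\<close> is exactly 1 and the others are positive;
  \<open>c \<ge> 2\<close> provides at least one other index. This is what places the memberships
  strictly between 0 and 1.\<close>

lemma Dsum_gt_one:
  assumes j: "j \<in> {1..c}" and c: "c \<ge> 2"
    and pos: "\<And>l. l \<in> {1..c} \<Longrightarrow> d i l m > 0"
  shows "Dsum c d i j m > 1"
proof -
  have "0 < (\<Sum>k\<in>{1..c}-{j}. ratio d i j k m powr bexp m)"
  proof (rule sum_pos)
    have "(if j = 1 then 2 else 1) \<in> {1..c} - {j}"
      using c by simp
    then show "{1..c} - {j} \<noteq> {}"
      by blast
    fix k assume "k \<in> {1..c} - {j}"
    then have "d i k m > 0" "d i j m > 0"
      using pos j by blast+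
    then show "0 < ratio d i j k m powr bexp m"
      by (simp add: ratio_def)
  qed simp
  moreover have "ratio d i j j m powr bexp m = 1"
    using pos[OF j] by (simp add: ratio_def)
  ultimately show ?thesis
    using j by (simp add: Dsum_def sum.remove[of _ j])
qed

lemma sum_membership:
  assumes "c \<ge> 1" and pos: "\<And>l. l \<in> {1..c} \<Longrightarrow> d i l m > 0"
  shows "(\<Sum>j=1..c. membership c d i j m) = 1"
proof -
  \<comment> \<open>The normalising constant: memberships are the inverse-distance weights
    \<open>d i j m powr - bexp m\<close> divided by their total.\<close>
  let ?S = "\<Sum>k=1..c. d i k m powr - bexp m"
  have "membership c d i j m = d i j m powr - bexp m / ?S" if "j \<in> {1..c}" for j
  proof -
    have "Dsum c d i j m = d i j m powr bexp m * ?S"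
      unfolding Dsum_def sum_distrib_left
      using pos that by (intro sum.cong) (auto simp: ratio_def powr_divide powr_minus_divide less_imp_le)
    then show ?thesis
      by (simp add: membership_def powr_minus_divide)
  qed
  then have "(\<Sum>j=1..c. membership c d i j m) = ?S / ?S"
    unfolding sum_divide_distrib by (intro sum.cong) auto
  moreover have "?S > 0"
    using assms by (intro sum_pos) (force dest: pos)+
  ultimately show ?thesis
    by simp
qed

lemma sum_weight:
  assumes j: "j \<in> {1..c}" and pos: "d i j m > 0"
  shows "(\<Sum>l=1..c. weight c d i j l m * h l) =
         (\<Sum>k=1..c. ratio d i j k m powr bexp m * (h j - h k))"
proof -
  \<comment> \<open>Since \<open>ratio d i j j m = 1\<close>, the diagonal weight
    \<open>Dsum - 1\<close> is also of the form \<open>Dsum\<close> minus the \<open>l\<close>-th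
    power, so one formula covers both cases of \<open>weight\<close>.\<close>
  have "weight c d i j l m * h l =
        (if l = j then Dsum c d i j m * h j else 0) - ratio d i j l m powr bexp m * h l" for l
    using pos by (auto simp: weight_def ratio_def algebra_simps)
  then show ?thesis
    using j by (simp add: sum_subtractf right_diff_distrib sum_distrib_right[symmetric] Dsum_def)
qed

lemma membership_has_real_derivative:
  assumes j: "j \<in> {1..c}" and c: "c \<ge> 2" and m: "m \<in> I" "m \<noteq> 1"
    and pos: "\<And>l. l \<in> {1..c} \<Longrightarrow> d i l m > 0"
    and d: "\<And>l. l \<in> {1..c} \<Longrightarrow> (d i l has_real_derivative - g l / d i l m) (at m within I)"
  shows "(membership c d i j has_real_derivative
           T1 c d i j m + 2 * (membership c d i j m)\<^sup>2 / (m - 1) *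
             (\<Sum>l=1..c. weight c d i j l m / (d i l m)\<^sup>2 * g l)) (at m within I)"
proof -
  define R where "R k = ratio d i j k m powr bexp m" for k
  \<comment> \<open>Given \<open>d' = - g / d\<close>, this is minus the logarithmic derivative of
    the distance, so the logarithmic derivative of the ratio is
    \<open>- (h j - h k)\<close>.\<close>
  define h where "h l = g l / (d i l m)\<^sup>2" for l
  have b: "(bexp has_real_derivative - 2 / (m - 1)\<^sup>2) (at m within I)"
    unfolding bexp_def using m
    by (auto intro!: derivative_eq_intros simp: power2_eq_square)
  \<comment> \<open>Logarithmic differentiation of r^b: the factor is b' ln r + b r'/r. The first
    summand leads to \<open>T1\<close>, the second to the weighted sum.\<close>
  have R: "((\<lambda>t. ratio d i j k t powr bexp t) has_real_derivative
        R k * (- 2 / (m - 1)\<^sup>2 * ln (ratio d i j k m) - bexp m * (h j - h k))) (at m within I)"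
    if k: "k \<in> {1..c}" for k
  proof -
    have r: "(ratio d i j k has_real_derivative - ratio d i j k m * (h j - h k)) (at m within I)"
      unfolding ratio_def
      using d[OF j] d[OF k] pos[OF j] pos[OF k]
      by (auto intro!: derivative_eq_intros simp: h_def field_simps power2_eq_square)
    have r_pos: "ratio d i j k m > 0"
      using pos[OF j] pos[OF k] by (simp add: ratio_def)
    show ?thesis
      using has_derivative_powr[OF r[unfolded has_field_derivative_def]
          b[unfolded has_field_derivative_def] r_pos m(1)] r_pos
      unfolding has_field_derivative_def R_def
      by (elim has_derivative_eq_rhs) (auto simp: fun_eq_iff field_simps)
  qed
  have D: "(Dsum c d i j has_real_derivative
      (\<Sum>k=1..c. R k * (- 2 / (m - 1)\<^sup>2 * ln (ratio d i j k m) - bexp m * (h j - h k))))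
      (at m within I)"
    unfolding Dsum_def using R by (intro DERIV_sum) auto
  also have "(\<Sum>k=1..c. R k * (- 2 / (m - 1)\<^sup>2 * ln (ratio d i j k m) - bexp m * (h j - h k))) =
      - (2 / (m - 1)\<^sup>2 * (\<Sum>k=1..c. R k * ln (ratio d i j k m))
         + bexp m * (\<Sum>k=1..c. R k * (h j - h k)))"
    by (simp add: sum_distrib_left sum.distrib[symmetric] sum_negf[symmetric] algebra_simps)
  also have "(\<Sum>k=1..c. R k * (h j - h k)) = (\<Sum>l=1..c. weight c d i j l m * h l)"
    unfolding R_def using sum_weight[OF j] pos[OF j] by simp
  finally have D: "(Dsum c d i j has_real_derivative
      - (2 / (m - 1)\<^sup>2 * (\<Sum>k=1..c. R k * ln (ratio d i j k m))
         + bexp m * (\<Sum>l=1..c. weight c d i j l m * h l))) (at m within I)" .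
  have "Dsum c d i j m \<noteq> 0"
    using Dsum_gt_one[OF j c, of d i m] pos by force
  \<comment> \<open>With u = 1/D one has u' = - u^2 D', which cancels the overall minus sign in
    \<open>D\<close>.\<close>
  from DERIV_inverse_fun[OF D this]
  have "(membership c d i j has_real_derivative
      (membership c d i j m)\<^sup>2 * (2 / (m - 1)\<^sup>2 * (\<Sum>k=1..c. R k * ln (ratio d i j k m))
         + bexp m * (\<Sum>l=1..c. weight c d i j l m * h l))) (at m within I)"
    by (simp add: membership_def[abs_def] inverse_eq_divide power2_eq_square algebra_simps)
  then show ?thesis
    by (rule DERIV_cong) (simp add: T1_def R_def h_def bexp_def algebra_simps)
qed

theorem proposition1:
  fixes alg :: variant
    and n c :: nat
    and I :: "real set"
    and x :: "nat \<Rightarrow> real^'p"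
    and v :: "nat \<Rightarrow> real \<Rightarrow> real^'p"
    and A :: "nat \<Rightarrow> real \<Rightarrow> real^'p^'p"
  assumes "c \<ge> 2"
    and "is_interval I" and "I \<subseteq> {1<..}"
    and "\<And>j. j \<in> {1..c} \<Longrightarrow> C1_within I (v j)"
    and "\<And>j. alg = GK \<Longrightarrow> j \<in> {1..c} \<Longrightarrow> C1_within I (A j)"
    and "\<And>j m. alg = GK \<Longrightarrow> j \<in> {1..c} \<Longrightarrow> m \<in> I \<Longrightarrow> sym_pos_def (A j m)"
    and "\<And>i j m. i \<in> {1..n} \<Longrightarrow> j \<in> {1..c} \<Longrightarrow> m \<in> I \<Longrightarrow> cdist alg x v A i j m > 0"
  shows "(\<forall>i\<in>{1..n}. \<forall>j\<in>{1..c}. \<forall>m\<in>I. membership c (cdist alg x v A) i j m \<in> {0<..<1})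
    \<and> (\<forall>i\<in>{1..n}. \<forall>j\<in>{1..c}. C1_within I (membership c (cdist alg x v A) i j))
    \<and> (\<forall>i\<in>{1..n}. \<forall>m\<in>I. (\<Sum>j=1..c. membership c (cdist alg x v A) i j m) = 1)
    \<and> (\<forall>i\<in>{1..n}. \<forall>j\<in>{1..c}. \<forall>m\<in>I.
           (membership c (cdist alg x v A) i j has_real_derivative
              T1 c (cdist alg x v A) i j m + T2 alg I c x v A i j m) (at m within I))"
proof -
  let ?d = "cdist alg x v A"
  note c = assms(1) and pos = assms(7)
  \<comment> \<open>Used with two choices of derivatives: the continuous ones to get the C^1
    property, and those picked by \<open>vector_derivative\<close> to get the formula with
    \<open>T2\<close>.\<close>
  have deriv: "(membership c ?d i j has_real_derivative
        T1 c ?d i j m + 2 * (membership c ?d i j m)\<^sup>2 / (m - 1) *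
          (\<Sum>l=1..c. weight c ?d i j l m / (?d i l m)\<^sup>2 * dist_slope alg x v A v' A' i l m))
        (at m within I)"
    and cdist_deriv: "\<And>l. l \<in> {1..c} \<Longrightarrow>
      (?d i l has_real_derivative - dist_slope alg x v A v' A' i l m / ?d i l m) (at m within I)"
    if i: "i \<in> {1..n}" and j: "j \<in> {1..c}" and m: "m \<in> I"
      and v': "\<And>l. l \<in> {1..c} \<Longrightarrow> (v l has_vector_derivative v' l m) (at m within I)"
      and A': "\<And>l. alg = GK \<Longrightarrow> l \<in> {1..c} \<Longrightarrow>
        (A l has_vector_derivative A' l m) (at m within I)"
    for i j m v' A'
  proof -
    show cdist_deriv: "(?d i l has_real_derivative
        - dist_slope alg x v A v' A' i l m / ?d i l m) (at m within I)" if l: "l \<in> {1..c}" for l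
      using v'[OF l] A'[OF _ l] assms(6)[OF _ l m] pos[OF i l m]
      by (intro cdist_has_real_derivative) (auto simp: sym_pos_def_def)
    show "(membership c ?d i j has_real_derivative
        T1 c ?d i j m + 2 * (membership c ?d i j m)\<^sup>2 / (m - 1) *
          (\<Sum>l=1..c. weight c ?d i j l m / (?d i l m)\<^sup>2 * dist_slope alg x v A v' A' i l m))
        (at m within I)"
      using assms(3) m pos[OF i _ m] cdist_deriv
      by (intro membership_has_real_derivative[OF j c m]) auto
  qed

  have "membership c ?d i j m \<in> {0<..<1}" if "i \<in> {1..n}" "j \<in> {1..c}" "m \<in> I" for i j m
    using Dsum_gt_one[of j c ?d i m] c pos that by (simp add: membership_def)

  moreover have "C1_within I (membership c ?d i j)" if i: "i \<in> {1..n}" and j: "j \<in> {1..c}" for i j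
  proof -
    from assms(4) obtain v' where v': "\<And>l. l \<in> {1..c} \<Longrightarrow>
        (\<forall>m\<in>I. (v l has_vector_derivative v' l m) (at m within I)) \<and> continuous_on I (v' l)"
      unfolding C1_within_def by metis
    from assms(5) obtain A' where A': "\<And>l. alg = GK \<Longrightarrow> l \<in> {1..c} \<Longrightarrow>
        (\<forall>m\<in>I. (A l has_vector_derivative A' l m) (at m within I)) \<and> continuous_on I (A' l)"
      unfolding C1_within_def by metis
    define u' where "u' m = T1 c ?d i j m + 2 * (membership c ?d i j m)\<^sup>2 / (m - 1) *
        (\<Sum>l=1..c. weight c ?d i j l m / (?d i l m)\<^sup>2 * dist_slope alg x v A v' A' i l m)" for m
    have u': "(membership c ?d i j has_real_derivative u' m) (at m within I)" if "m \<in> I" for m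
      unfolding u'_def using v' A' that by (intro deriv[OF i j]) auto
    have cont_v: "continuous_on I (v l)" "continuous_on I (v' l)" if "l \<in> {1..c}" for l
      using v'[OF that] by (auto intro: continuous_on_vector_derivative)
    have cont_A: "continuous_on I (A l)" "continuous_on I (A' l)" if "alg = GK" "l \<in> {1..c}" for l
      using A'[OF that] by (auto intro: continuous_on_vector_derivative)
    have cont_d: "continuous_on I (?d i l)" if "l \<in> {1..c}" for l
      by (rule DERIV_continuous_on, rule cdist_deriv[OF i j]) (use v' A' that in auto)
    have cont_slope: "continuous_on I (dist_slope alg x v A v' A' i l)" if l: "l \<in> {1..c}" for l
      using cont_v[OF l] cont_A[OF _ l] unfolding dist_slope_def
      by (cases alg) (auto intro!: continuous_intros
          bounded_bilinear.continuous_on[OF bounded_bilinear_matrix_vector_mult])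
    have d_nz: "?d i l m \<noteq> 0" if "l \<in> {1..c}" "m \<in> I" for l m
      using pos[OF i that] by simp
    have cont_r: "continuous_on I (ratio ?d i j l)" if "l \<in> {1..c}" for l
      unfolding ratio_def using d_nz that by (intro continuous_intros cont_d j) auto
    have r_nz: "ratio ?d i j l m \<noteq> 0" if "l \<in> {1..c}" "m \<in> I" for l m
      using d_nz that j by (simp add: ratio_def)
    have m_nz: "m - 1 \<noteq> 0" if "m \<in> I" for m
      using assms(3) that by auto
    have cont_b: "continuous_on I bexp"
      unfolding bexp_def using m_nz by (intro continuous_intros) auto
    \<comment> \<open>Continuity of the distances and of the membership comes for free from their
      differentiability; only the remaining factors of \<open>u'\<close> are treated by continuity
      rules.\<close>
    have cont_u: "continuous_on I (membership c ?d i j)"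
      by (rule DERIV_continuous_on[OF u'])
    have cont_w: "continuous_on I (weight c ?d i j l)" if "l \<in> {1..c}" for l
      unfolding weight_def Dsum_def using r_nz that
      by (cases "l = j") (auto intro!: continuous_intros cont_r cont_b)
    \<comment> \<open>Nonzero ratios give continuity of \<open>powr\<close> and \<open>ln\<close>;
      nonzero distances and \<open>m - 1\<close> give that of the quotients.\<close>
    have "continuous_on I u'"
      unfolding u'_def T1_def using r_nz d_nz m_nz
      by (intro continuous_intros cont_r cont_b cont_u cont_d cont_w cont_slope) auto
    then show ?thesis
      unfolding C1_within_def using u'
      by (auto simp: has_real_derivative_iff_has_vector_derivative)
  qed

  moreover have "(\<Sum>j=1..c. membership c ?d i j m) = 1" if "i \<in> {1..n}" "m \<in> I" for i m
    using sum_membership[of c ?d i m] c pos that by simp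

  moreover have "(membership c ?d i j has_real_derivative
      T1 c ?d i j m + T2 alg I c x v A i j m) (at m within I)"
    if "i \<in> {1..n}" "j \<in> {1..c}" "m \<in> I" for i j m
    unfolding T2_dist_slope
  proof (rule deriv[OF that])
    \<comment> \<open>Existence of some derivative suffices: \<open>vector_derivative\<close> then
      selects a valid one, even where it is not unique.\<close>
    show "(v l has_vector_derivative vector_derivative (v l) (at m within I)) (at m within I)"
      if "l \<in> {1..c}" for l
      using assms(4)[OF that] \<open>m \<in> I\<close> unfolding C1_within_def
      by (metis differentiableI_vector vector_derivative_works)
    show "(A l has_vector_derivative vector_derivative (A l) (at m within I)) (at m within I)"
      if "alg = GK" "l \<in> {1..c}" for l
      using assms(5)[OF that] \<open>m \<in> I\<close> unfolding C1_within_def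
      by (metis differentiableI_vector vector_derivative_works)
  qed

  ultimately show ?thesis
    by blast
qed

end
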